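(* Assume that $P(x,y)>0$ for all $x,y\in X$ and that there is a constant $C_*\ge 1$ with $P_2(x,y)\le C_*P(x,y)$ for all $x,y\in X$; that $\sup_{x,y\in X}P(x,y)/\mu(y)<\infty$; and that the potential $V$ is confining. Then there exist $\kappa\in(0,1)$ and $C>0$ such that $$\sup_{x\in X}\ \sup_{\|g\|_{\ell^\infty(\nu)}\le1}\big|\mathcal Q_ng(x)-\bar\nu(g)\big|\le C\kappa^n,\quad n\in\mathbb N.$$ Moreover, $\bar\nu$ is the only stationary probability measure of the semigroup $\{\mathcal Q_n:n\in\mathbb N_0\}$. The same statement holds for the dual semigroup $\{\widehat{\mathcal Q}_n:n\in\mathbb N_0\}$.
   Context: $X$ is a countably infinite set, $\mathbb N=\{1,2,\dots\}$, $\mathbb N_0=\mathbb N\cup\{0\}$. $P:X\times X\to[0,1]$ is a (sub-)probability kernel, i.e. $\sum_{y\in X}P(x,y)\le1$ for all $x$. It is assumed throughout that there are a (sub-)probability kernel $\widehat P:X\times X\to[0,1]$ and a measure $\mu:X\to(0,\infty)$ with $\mu(x)P(x,y)=\mu(y)\widehat P(y,x)$ for all $x,y\in X$. Put $P_2(x,y)=\sum_{z\in X}P(x,z)P(z,y)$. A potential is a function $V:X\to(0,\infty)$ with $\inf_{x\in X}V(x)>0$ (standing assumption). It is confining if for every $M\in\mathbb N$ there is a finite set $B_M\subset X$ with $V(x)\ge M$ for all $x\in X\setminus B_M$. Let $\mathcal U f(x)=\frac1{V(x)}\sum_{y}P(x,y)f(y)$ and $\widehat{\mathcal U}f(x)=\sum_y\widehat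 P(x,y)\frac1{V(y)}f(y)$; these are mutually adjoint on $\ell^2(\mu)$. Let $\mathcal U_n=\mathcal U^n$, $\widehat{\mathcal U}_n=\widehat{\mathcal U}^n$. Under the hypotheses of the claim, $\mathcal U,\widehat{\mathcal U}$ are compact on $\ell^2(\mu)$ and $\lambda_0:=\sup_{\lambda\in\sigma(\mathcal U)}|\lambda|=\sup_{\lambda\in\sigma(\widehat{\mathcal U})}|\lambda|>0$ is a simple eigenvalue of both; $\varphi_0,\widehat\varphi_0$ denote the corresponding strictly positive eigenfunctions, $\mathcal U\varphi_0=\lambda_0\varphi_0$, $\widehat{\mathcal U}\widehat\varphi_0=\lambda_0\widehat\varphi_0$, normalized by $\|\varphi_0\|_{\ell^2(\mu)}=\|\widehat\varphi_0\|_{\ell^2(\mu)}=1$. Let $\nu(x)=\varphi_0(x)\widehat\varphi_0(x)\mu(x)$, a finite measure with total mass $\|\nu\|=\sum_x\nu(x)$, and $\bar\nu(f)=\frac1{\|\nu\|}\sum_yf(y)\nu(y)$. The intrinsic semigroups are $\mathcal Q_nf=\lambda_0^{-n}\varphi_0^{-1}\,\mathcal U_n(f\varphi_0)$ and $\widehat{\mathcal Q}_nf=\lambda_0^{-n}\widehat\varphi_0^{-1}\,\widehat{\mathcal U}_n(f\widehat\varphi_0)$; both are conservative Markov semigroups. A probability measure $\pi$ on $X$ is stationary for $\{\mathcal Q_n\}$ if $\pi(\mathcal Q_nf)=\pi(f)$ for all $n\in\mathbb N_0$ and all bounded $f$; similarly for $\{\widehat{\mathcal Q}_n\}$. *)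

theory Defs
  imports "HOL-Probability.Probability" "HOL-Probability.Essential_Supremum"
begin

text \<open>The countably infinite state space is the whole type \<open>'a\<close>; sums over it are
  unconditional sums \<open>infsum\<close>.\<close>

text \<open>Summability is required explicitly, because \<open>infsum\<close> is 0 on non-summable families.\<close>

definition subprob_kernel :: "('a \<Rightarrow> 'a \<Rightarrow> real) \<Rightarrow> bool" where
  "subprob_kernel K \<longleftrightarrow>
     (\<forall>x y. 0 \<le> K x y \<and> K x y \<le> 1) \<and>
     (\<forall>x. K x summable_on UNIV \<and> (\<Sum>\<^sub>\<infinity>y. K x y) \<le> 1)"

definition two_step :: "('a \<Rightarrow> 'a \<Rightarrow> real) \<Rightarrow> 'a \<Rightarrow> 'a \<Rightarrow> real" where
  "two_step P x y = (\<Sum>\<^sub>\<infinity>z. P x z * P z y)"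

definition potential :: "('a \<Rightarrow> real) \<Rightarrow> bool" where
  "potential V \<longleftrightarrow> (\<forall>x. V x > 0) \<and> (INF x. V x) > 0"

definition confining :: "('a \<Rightarrow> real) \<Rightarrow> bool" where
  "confining V \<longleftrightarrow> (\<forall>M::nat. M \<ge> 1 \<longrightarrow> (\<exists>B. finite B \<and> (\<forall>x. x \<notin> B \<longrightarrow> V x \<ge> real M)))"

text \<open>The operators and the space \<open>\<ell>\<^sup>2(\<mu>)\<close> are polymorphic in the scalars: the complex instance
  is used for the spectrum, the real one for eigenfunctions and semigroups.\<close>

definition U_op ::
  "('a \<Rightarrow> 'a \<Rightarrow> real) \<Rightarrow> ('a \<Rightarrow> real) \<Rightarrow> ('a \<Rightarrow> 'b::real_normed_vector) \<Rightarrow> 'a \<Rightarrow> 'b" where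
  "U_op P V f x = (1 / V x) *\<^sub>R (\<Sum>\<^sub>\<infinity>y. P x y *\<^sub>R f y)"

definition U_hat ::
  "('a \<Rightarrow> 'a \<Rightarrow> real) \<Rightarrow> ('a \<Rightarrow> real) \<Rightarrow> ('a \<Rightarrow> 'b::real_normed_vector) \<Rightarrow> 'a \<Rightarrow> 'b" where
  "U_hat Phat V f x = (\<Sum>\<^sub>\<infinity>y. (Phat x y * (1 / V y)) *\<^sub>R f y)"

definition ell2 :: "('a \<Rightarrow> real) \<Rightarrow> ('a \<Rightarrow> 'b::real_normed_vector) set" where
  "ell2 \<mu> = {f. (\<lambda>x. (norm (f x))\<^sup>2 * \<mu> x) summable_on UNIV}"

definition ell2_norm :: "('a \<Rightarrow> real) \<Rightarrow> ('a \<Rightarrow> 'b::real_normed_vector) \<Rightarrow> real" where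
  "ell2_norm \<mu> f = sqrt (\<Sum>\<^sub>\<infinity>x. (norm (f x))\<^sup>2 * \<mu> x)"

text \<open>Spectrum of an operator \<open>T\<close> on complex \<open>\<ell>\<^sup>2(\<mu>)\<close>: the \<open>z\<close> for which \<open>z I - T\<close> has no bounded
  two-sided inverse \<open>R\<close> (linearity of \<open>R\<close> on \<open>\<ell>\<^sup>2(\<mu>)\<close> is automatic for linear \<open>T\<close>).\<close>

definition resolvent_set ::
  "('a \<Rightarrow> real) \<Rightarrow> (('a \<Rightarrow> complex) \<Rightarrow> 'a \<Rightarrow> complex) \<Rightarrow> complex set" where
  "resolvent_set \<mu> T = {z. \<exists>R K. \<forall>f\<in>ell2 \<mu>.
      R f \<in> ell2 \<mu> \<and> ell2_norm \<mu> (R f) \<le> K * ell2_norm \<mu> f \<and>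
      R (\<lambda>x. z * f x - T f x) = f \<and>
      (\<lambda>x. z * R f x - T (R f) x) = f}"

definition spectral_rad ::
  "('a \<Rightarrow> real) \<Rightarrow> (('a \<Rightarrow> complex) \<Rightarrow> 'a \<Rightarrow> complex) \<Rightarrow> real" where
  "spectral_rad \<mu> T = (SUP z\<in>- resolvent_set \<mu> T. cmod z)"

definition positive_normalized_eigenfunction ::
  "('a \<Rightarrow> real) \<Rightarrow> (('a \<Rightarrow> real) \<Rightarrow> 'a \<Rightarrow> real) \<Rightarrow> real \<Rightarrow> ('a \<Rightarrow> real) \<Rightarrow> bool" where
  "positive_normalized_eigenfunction \<mu> T l \<phi> \<longleftrightarrow>
     \<phi> \<in> ell2 \<mu> \<and> ell2_norm \<mu> \<phi> = 1 \<and> (\<forall>x. \<phi> x > 0) \<and> (\<forall>x. T \<phi> x = l * \<phi> x)"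

text \<open>\<open>intrinsic T l \<phi> n\<close> is the \<open>n\<close>-th intrinsic operator
  \<open>f \<mapsto> l\<^sup>-\<^sup>n \<phi>\<^sup>-\<^sup>1 T\<^sup>n (f \<phi>)\<close>.\<close>

definition intrinsic ::
  "(('a \<Rightarrow> real) \<Rightarrow> 'a \<Rightarrow> real) \<Rightarrow> real \<Rightarrow> ('a \<Rightarrow> real) \<Rightarrow> nat \<Rightarrow> ('a \<Rightarrow> real) \<Rightarrow> 'a \<Rightarrow> real" where
  "intrinsic T l \<phi> n f x = (T ^^ n) (\<lambda>y. f y * \<phi> y) x / (l ^ n * \<phi> x)"

definition nu :: "('a \<Rightarrow> real) \<Rightarrow> ('a \<Rightarrow> real) \<Rightarrow> ('a \<Rightarrow> real) \<Rightarrow> 'a measure" where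
  "nu \<mu> \<phi> \<phi>' = density (count_space UNIV) (\<lambda>x. ennreal (\<phi> x * \<phi>' x * \<mu> x))"

definition normalized :: "'a measure \<Rightarrow> 'a measure" where
  "normalized m = scale_measure (1 / emeasure m (space m)) m"

definition stationary :: "(nat \<Rightarrow> ('a \<Rightarrow> real) \<Rightarrow> 'a \<Rightarrow> real) \<Rightarrow> 'a measure \<Rightarrow> bool" where
  "stationary S \<pi> \<longleftrightarrow> prob_space \<pi> \<and> sets \<pi> = UNIV \<and>
     (\<forall>n f. bounded (range f) \<longrightarrow> (\<integral>x. S n f x \<partial>\<pi>) = (\<integral>x. f x \<partial>\<pi>))"

text \<open>Uniform geometric convergence of \<open>S n g\<close> to the mean of \<open>g\<close> under the normalization of \<open>m\<close>,
  over the unit ball of \<open>\<ell>\<^sup>\<infinity>(m)\<close>; the suprema are taken in \<open>[0,\<infinity>]\<close>.\<close>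

definition uniform_geometric_ergodic ::
  "(nat \<Rightarrow> ('a \<Rightarrow> real) \<Rightarrow> 'a \<Rightarrow> real) \<Rightarrow> 'a measure \<Rightarrow> bool" where
  "uniform_geometric_ergodic S m \<longleftrightarrow>
     (\<exists>\<kappa> C. 0 < \<kappa> \<and> \<kappa> < 1 \<and> 0 < C \<and>
       (\<forall>n\<ge>1. (SUP x. SUP g\<in>{g. esssup m (\<lambda>y. ereal \<bar>g y\<bar>) \<le> 1}.
                  ennreal \<bar>S n g x - (\<integral>y. g y \<partial>normalized m)\<bar>) \<le> ennreal (C * \<kappa> ^ n)))"

end

theory Submission
  imports Defs
begin

text \<open>Since \<open>P\<^sub>2 \<le> C P\<close> and \<open>V\<close> is confining, the part of \<open>\<lambda> V \<phi> = P \<phi>\<close> that comes from outside a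
  large finite set can be absorbed, which gives \<open>V \<phi> \<le> C' P(\<cdot>, x\<^sub>0)\<close>. Hence the intrinsic kernel
  \<open>P(x, y) \<phi>(y) / (\<lambda> V(x) \<phi>(x))\<close> charges the single point \<open>x\<^sub>0\<close> with mass at least \<open>\<delta> > 0\<close>
  uniformly in \<open>x\<close>; this is Doeblin's condition, and oscillations contract by \<open>1 - \<delta>\<close> in every step.
  The dual case is the same argument for \<open>\<psi> = \<phi>'/V\<close>, because \<open>\<lambda> V \<psi> = P' \<psi>\<close>, where \<open>P'\<close>
  inherits \<open>P'\<^sub>2 \<le> C P'\<close> by duality.\<close>

section \<open>Infinite sums and expectations of discrete distributions\<close>

lemma has_sum_finite_sum:
  fixes f :: "'i \<Rightarrow> 'a \<Rightarrow> real"
  assumes "finite Y" and "\<And>i. i \<in> Y \<Longrightarrow> (f i has_sum s i) A"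
  shows "((\<lambda>x. \<Sum>i\<in>Y. f i x) has_sum (\<Sum>i\<in>Y. s i)) A"
  using assms by (induction rule: finite_induct) (auto intro: has_sum_add)

lemma nn_integral_count_space_summable:
  fixes f :: "'a \<Rightarrow> real"
  assumes "f summable_on A" and "\<And>x. 0 \<le> f x"
  shows "(\<integral>\<^sup>+x. ennreal (f x) \<partial>count_space A) = ennreal (\<Sum>\<^sub>\<infinity>x\<in>A. f x)"
proof -
  \<comment> \<open>For real families summability is absolute summability, that is, integrability
    with respect to counting measure.\<close>
  have abs: "Infinite_Set_Sum.abs_summable_on f A"
    by (metis assms(1) abs_summable_equivalent summable_on_iff_abs_summable_on_real)
  then have "(\<integral>\<^sup>+x. ennreal (f x) \<partial>count_space A) = ennreal (infsetsum f A)"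
    using assms(2) unfolding Infinite_Set_Sum.abs_summable_on_def infsetsum_def
    by (intro nn_integral_eq_integral) auto
  with infsetsum_infsum[OF abs] show ?thesis by simp
qed

lemma expectation_pmf_eq_infsum:
  fixes f :: "'a \<Rightarrow> real"
  assumes "bounded (range f)"
  shows "measure_pmf.expectation p f = (\<Sum>\<^sub>\<infinity>x. pmf p x * f x)"
proof -
  obtain B where B: "\<And>x. \<bar>f x\<bar> \<le> B"
    using assms by (auto simp: bounded_iff)
  have "integrable (measure_pmf p) f"
    by (rule measure_pmf.integrable_const_bound[where B=B]) (auto simp: B)
  then have "integrable (count_space UNIV) (\<lambda>x. pmf p x * f x)"
    by (simp add: measure_pmf_eq_density integrable_density)
  then have "Infinite_Set_Sum.abs_summable_on (\<lambda>x. pmf p x * f x) UNIV"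
    by (simp add: Infinite_Set_Sum.abs_summable_on_def)
  then show ?thesis
    by (simp add: pmf_expectation_eq_infsetsum infsetsum_infsum)
qed

lemma integral_bind_pmf_bounded:
  fixes f :: "'b \<Rightarrow> real"
  assumes "bounded (range f)"
  shows "measure_pmf.expectation (bind_pmf p k) f
    = measure_pmf.expectation p (\<lambda>x. measure_pmf.expectation (k x) f)"
proof -
  obtain B where B: "\<And>x. \<bar>f x\<bar> \<le> B"
    using assms by (auto simp: bounded_iff)
  show ?thesis
    unfolding measure_pmf_bind
    by (rule integral_bind[where K="count_space UNIV" and B=B and B'=1])
      (auto simp: B measure_pmf.finite_measure_axioms measure_pmf_in_subprob_algebra)
qed

lemma expectation_pmf_bounds:
  fixes f :: "'a \<Rightarrow> real"
  assumes "\<And>x. a \<le> f x" and "\<And>x. f x \<le> b"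
  shows "a \<le> measure_pmf.expectation p f" and "measure_pmf.expectation p f \<le> b"
proof -
  have "\<bar>f x\<bar> \<le> \<bar>a\<bar> + \<bar>b\<bar>" for x
    using assms(1)[of x] assms(2)[of x] by linarith
  then have int: "integrable (measure_pmf p) f"
    by (intro measure_pmf.integrable_const_bound[where B="\<bar>a\<bar> + \<bar>b\<bar>"]) auto
  show "a \<le> measure_pmf.expectation p f"
    using int assms(1) by (intro measure_pmf.integral_ge_const) auto
  show "measure_pmf.expectation p f \<le> b"
    using int assms(2) by (intro measure_pmf.integral_le_const) auto
qed

text \<open>Since \<open>f - a\<close> is nonnegative, its mean is at least the contribution of the
  atom at \<open>z\<close>. Any lower bound \<open>\<delta>\<close> for that atom will do, so that
  one \<open>\<delta>\<close> can serve all rows of a kernel.\<close>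

lemma expectation_pmf_lower_bound:
  fixes f :: "'a \<Rightarrow> real"
  assumes "\<And>x. a \<le> f x" and "\<And>x. f x \<le> b" and "\<delta> \<le> pmf p z"
  shows "\<delta> * f z + (1 - \<delta>) * a \<le> measure_pmf.expectation p f"
proof -
  have "\<bar>f x\<bar> \<le> \<bar>a\<bar> + \<bar>b\<bar>" for x
    using assms(1)[of x] assms(2)[of x] by linarith
  then have int: "integrable (measure_pmf p) f"
    by (intro measure_pmf.integrable_const_bound[where B="\<bar>a\<bar> + \<bar>b\<bar>"]) auto
  have "\<delta> * (f z - a) \<le> pmf p z * (f z - a)"
    using assms(1)[of z] assms(3) by (intro mult_right_mono) auto
  also have "\<dots> = measure_pmf.expectation p (\<lambda>x. indicator {z} x * (f z - a))"
    by (simp add: measure_pmf_single)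
  also have "\<dots> \<le> measure_pmf.expectation p (\<lambda>x. f x - a)"
  proof (rule integral_mono)
    show "integrable (measure_pmf p) (\<lambda>x. indicator {z} x * (f z - a))"
      by (rule measure_pmf.integrable_const_bound[where B="\<bar>f z - a\<bar>"]) (auto simp: indicator_def)
  qed (use int assms(1) in \<open>auto simp: indicator_def\<close>)
  also have "\<dots> = measure_pmf.expectation p f - a"
    using int by simp
  finally show ?thesis by (simp add: algebra_simps)
qed

lemma expectation_pmf_upper_bound:
  fixes f :: "'a \<Rightarrow> real"
  assumes "\<And>x. a \<le> f x" and "\<And>x. f x \<le> b" and "\<delta> \<le> pmf p z"
  shows "measure_pmf.expectation p f \<le> \<delta> * f z + (1 - \<delta>) * b"
  using expectation_pmf_lower_bound[of "- b" "\<lambda>x. - f x" "- a" \<delta> p z] assms by simp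

section \<open>Markov operators under Doeblin's condition\<close>

definition markov_op :: "('a \<Rightarrow> 'a pmf) \<Rightarrow> ('a \<Rightarrow> real) \<Rightarrow> 'a \<Rightarrow> real" where
  "markov_op k f x = measure_pmf.expectation (k x) f"

lemma markov_op_power_bounds:
  assumes "\<And>x. a \<le> f x" and "\<And>x. f x \<le> b"
  shows "a \<le> (markov_op k ^^ n) f x \<and> (markov_op k ^^ n) f x \<le> b"
proof (induction n arbitrary: x)
  case (Suc n)
  then show ?case
    using expectation_pmf_bounds[of a "(markov_op k ^^ n) f" b "k x"] by (simp add: markov_op_def[of k "(markov_op k ^^ n) f"])
qed (use assms in simp)

lemma bounded_markov_op_power:
  assumes "bounded (range f)"
  shows "bounded (range ((markov_op k ^^ n) f))"
proof -
  obtain B where "\<And>x. \<bar>f x\<bar> \<le> B"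
    using assms by (auto simp: bounded_iff)
  then have B: "- B \<le> f x" "f x \<le> B" for x
    by (simp_all add: abs_le_iff minus_le_iff)
  show ?thesis
    unfolding bounded_iff using markov_op_power_bounds[OF B, where k=k and n=n]
    by (intro exI[of _ B]) (auto simp: abs_le_iff minus_le_iff)
qed

text \<open>The equation \<open>bind_pmf p k = p\<close> is invariance of \<open>p\<close> under the
  kernel; each step moves one application of the kernel from the function to the measure.\<close>

lemma expectation_markov_op_power:
  assumes "bind_pmf p k = p" and "bounded (range f)"
  shows "measure_pmf.expectation p ((markov_op k ^^ n) f) = measure_pmf.expectation p f"
proof (induction n)
  case (Suc n)
  have "measure_pmf.expectation p (markov_op k ((markov_op k ^^ n) f))
    = measure_pmf.expectation (bind_pmf p k) ((markov_op k ^^ n) f)"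
    using bounded_markov_op_power[OF assms(2)]
    by (simp add: integral_bind_pmf_bounded markov_op_def[abs_def])
  with Suc assms(1) show ?case by simp
qed simp

text \<open>The atom at \<open>z\<close> contributes the same amount to every row, so only the
  remaining mass \<open>1 - \<delta>\<close> can tell two starting points apart. The lower end
  \<open>c\<close> is existential because the enclosing interval moves with \<open>n\<close>; only
  its length is controlled.\<close>

lemma doeblin_contraction:
  assumes "\<And>x. \<delta> \<le> pmf (k x) z" and "\<delta> \<le> 1"
    and "\<And>x. a \<le> f x" and "\<And>x. f x \<le> b"
  shows "\<exists>c. \<forall>x. c \<le> (markov_op k ^^ n) f x \<and> (markov_op k ^^ n) f x \<le> c + (1 - \<delta>) ^ n * (b - a)"
proof (induction n)
  case 0
  show ?case using assms(3,4) by (intro exI[of _ a]) simp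
next
  case (Suc n)
  define g where "g = (markov_op k ^^ n) f"
  define w where "w = (1 - \<delta>) ^ n * (b - a)"
  obtain c where c: "\<And>x. c \<le> g x" "\<And>x. g x \<le> c + w"
    using Suc unfolding g_def w_def by blast
  have "\<delta> * g z + (1 - \<delta>) * c \<le> markov_op k g x"
    "markov_op k g x \<le> (\<delta> * g z + (1 - \<delta>) * c) + (1 - \<delta>) * w" for x
    using expectation_pmf_lower_bound[OF c assms(1)[of x]]
      expectation_pmf_upper_bound[OF c assms(1)[of x]]
    by (simp_all add: markov_op_def algebra_simps)
  then show ?case
    by (intro exI[of _ "\<delta> * g z + (1 - \<delta>) * c"]) (simp add: g_def w_def mult.assoc)
qed

text \<open>By invariance the mean of \<open>f\<close> is also the mean of its \<open>n\<close>-th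
  iterate, so it lies in the same short interval as all values of that iterate.\<close>

lemma doeblin_convergence:
  assumes "\<And>x. \<delta> \<le> pmf (k x) z" and "\<delta> \<le> 1" and "bind_pmf p k = p"
    and "\<And>x. \<bar>f x\<bar> \<le> b"
  shows "\<bar>(markov_op k ^^ n) f x - measure_pmf.expectation p f\<bar> \<le> 2 * b * (1 - \<delta>) ^ n"
proof -
  have f: "- b \<le> f x" "f x \<le> b" for x
    using assms(4)[of x] by linarith+
  obtain c where c: "\<And>x. c \<le> (markov_op k ^^ n) f x"
    "\<And>x. (markov_op k ^^ n) f x \<le> c + (1 - \<delta>) ^ n * (b - - b)"
    using doeblin_contraction[where k=k and f=f and n=n, OF assms(1,2) f] by blast
  have "bounded (range f)"
    using assms(4) by (auto simp: bounded_iff)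
  then have "measure_pmf.expectation p ((markov_op k ^^ n) f) = measure_pmf.expectation p f"
    by (rule expectation_markov_op_power[OF assms(3)])
  then show ?thesis
    using expectation_pmf_bounds[where p=p and f="(markov_op k ^^ n) f", OF c] c(1)[of x] c(2)[of x] by (simp add: abs_le_iff algebra_simps)
qed

lemma doeblin_stationary:
  assumes S: "\<And>n f. bounded (range f) \<Longrightarrow> S n f = (markov_op k ^^ n) f"
    and "bind_pmf p k = p"
  shows "stationary S (measure_pmf p)"
  unfolding stationary_def
  using expectation_markov_op_power[OF assms(2)] by (simp add: S prob_space_measure_pmf)

text \<open>The iterates of a bounded function converge uniformly to its \<open>p\<close>-mean,
  while stationarity keeps their \<open>\<pi>\<close>-mean fixed. Both means therefore agree, and
  indicator functions determine the measure.\<close>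

lemma doeblin_stationary_unique:
  assumes S: "\<And>n f. bounded (range f) \<Longrightarrow> S n f = (markov_op k ^^ n) f"
    and d: "\<And>x. \<delta> \<le> pmf (k x) z" "0 < \<delta>" "\<delta> \<le> 1" and p: "bind_pmf p k = p"
    and stat: "stationary S \<pi>"
  shows "\<pi> = measure_pmf p"
proof -
  interpret prob_space \<pi>
    using stat by (simp add: stationary_def)
  have sets: "sets \<pi> = UNIV"
    using stat by (simp add: stationary_def)
  then have sp: "space \<pi> = UNIV"
    using sets.top[of \<pi>] sets.sets_into_space[of UNIV \<pi>] by auto
  have meas: "f \<in> borel_measurable \<pi>" for f :: "'a \<Rightarrow> real"
    using sets by (auto simp: measurable_def sp)
  have mean: "expectation f = measure_pmf.expectation p f" if b: "\<And>x. \<bar>f x\<bar> \<le> 1" for f :: "'a \<Rightarrow> real"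
  proof -
    have bd: "bounded (range f)"
      unfolding bounded_iff by (intro exI[of _ 1]) (simp add: b)
    have "\<bar>expectation f - measure_pmf.expectation p f\<bar> \<le> 2 * (1 - \<delta>) ^ n" for n
    proof -
      let ?g = "(markov_op k ^^ n) f"
      have g: "\<bar>?g x - measure_pmf.expectation p f\<bar> \<le> 2 * (1 - \<delta>) ^ n" for x
        using doeblin_convergence[where f=f and n=n and x=x, OF d(1,3) p b] by simp
      have "\<bar>?g x\<bar> \<le> \<bar>measure_pmf.expectation p f\<bar> + 2 * (1 - \<delta>) ^ n" for x
        using g[of x] by linarith
      then have int: "integrable \<pi> ?g"
        by (intro integrable_const_bound[where B="\<bar>measure_pmf.expectation p f\<bar> + 2 * (1 - \<delta>) ^ n"])
          (auto simp: meas)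
      have "expectation f = expectation ?g"
        using stat bd by (auto simp: stationary_def S)
      moreover have "expectation ?g \<le> measure_pmf.expectation p f + 2 * (1 - \<delta>) ^ n"
        using int g by (intro integral_le_const) (auto simp: abs_le_iff algebra_simps)
      moreover have "measure_pmf.expectation p f - 2 * (1 - \<delta>) ^ n \<le> expectation ?g"
        using int g by (intro integral_ge_const) (auto simp: abs_le_iff algebra_simps)
      ultimately show ?thesis by (simp add: abs_le_iff)
    qed
    moreover have "(\<lambda>n. 2 * (1 - \<delta>) ^ n) \<longlonglongrightarrow> 2 * 0"
      using d by (intro tendsto_mult tendsto_const LIMSEQ_power_zero) auto
    ultimately have "\<bar>expectation f - measure_pmf.expectation p f\<bar> \<le> 2 * 0"
      by (intro LIMSEQ_le_const) blast+
    then show ?thesis by simp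
  qed
  have "expectation (indicat_real A) = measure_pmf.expectation p (indicat_real A)" for A
    by (rule mean) simp
  then have "prob A = measure_pmf.prob p A" for A
    using sets by (simp add: sp)
  then show ?thesis
    by (intro measure_eqI) (auto simp: sets emeasure_eq_measure measure_pmf.emeasure_eq_measure)
qed

section \<open>Comparison of the eigenfunction with one column of the kernel\<close>

text \<open>Let \<open>F\<close> be the part of the eigenvalue sum outside a finite set
  \<open>B\<close>. The part inside is at most \<open>A * K x z\<close>. Outside, \<open>V\<close>
  is so large that \<open>2 * C * \<phi> y \<le> A * K y z + F y\<close>; applying \<open>K\<close>
  and \<open>two_step K \<le> C * K\<close> yields \<open>2 * F x \<le> A * K x z + F x\<close>, and
  \<open>F x\<close> is absorbed.\<close>

lemma eigenfunction_le_kernel: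
  fixes K :: "'a \<Rightarrow> 'a \<Rightarrow> real"
  assumes sub: "subprob_kernel K" and pos: "\<And>x y. 0 < K x y"
    and C: "0 < C" "\<And>x y. two_step K x y \<le> C * K x y"
    and V: "confining V" and phi: "\<And>x. 0 < \<phi> x" and lam: "0 < l"
    and eig: "\<And>x. ((\<lambda>y. K x y * \<phi> y) has_sum l * V x * \<phi> x) UNIV"
  shows "\<exists>D>0. \<forall>x. l * V x * \<phi> x \<le> D * K x z"
proof -
  have nonneg [simp]: "0 \<le> K x y" "0 \<le> \<phi> x" for x y
    using pos[of x y] phi[of x] by simp_all
  have sum_K2: "(\<Sum>y\<in>Y. K x y * K y w) \<le> C * K x w" if "finite Y" for Y x w
  proof -
    have le1: "K y w \<le> 1" for y
      using sub by (simp add: subprob_kernel_def)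
    have "K x summable_on UNIV"
      using sub by (simp add: subprob_kernel_def)
    \<comment> \<open>Summability ensures that \<open>two_step\<close> is a genuine sum here and not
      the default value 0.\<close>
    then have "(\<lambda>y. K x y * K y w) summable_on UNIV"
      by (rule summable_on_comparison_test) (simp_all add: mult_left_le le1)
    then have "(\<Sum>y\<in>Y. K x y * K y w) \<le> two_step K x w"
      unfolding two_step_def using that by (intro finite_sum_le_infsum) auto
    with C(2)[of x w] show ?thesis by simp
  qed
  \<comment> \<open>With \<open>l * M \<ge> 2 * C\<close> the absorbed term gets the factor 1/2;
    \<open>1 \<le> M\<close> is what \<open>confining\<close> asks for.\<close>
  obtain M where M: "1 \<le> M" "2 * C / l \<le> real M"
    using real_arch_simple[of "max 1 (2 * C / l)"] by auto
  then obtain B where B: "finite B" "\<And>x. x \<notin> B \<Longrightarrow> real M \<le> V x"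
    using V unfolding confining_def by blast
  define F where "F x = (\<Sum>\<^sub>\<infinity>y\<in>- B. K x y * \<phi> y)" for x
  define A where "A = (\<Sum>y\<in>B. C * \<phi> y / K y z)"
  have A: "0 \<le> A"
    unfolding A_def using C(1) by (intro sum_nonneg) simp
  have summable: "(\<lambda>y. K x y * \<phi> y) summable_on S" for x S
    using eig[of x] summable_on_subset_banach[of _ UNIV S] by (auto simp: summable_on_def)
  then have F: "((\<lambda>y. K x y * \<phi> y) has_sum F x) (- B)" for x
    unfolding F_def by (rule has_sum_infsum)
  \<comment> \<open>A single path from \<open>x\<close> through \<open>y\<close> to \<open>z\<close>
    already gives \<open>K x y * K y z \<le> C * K x z\<close>; dividing by \<open>K y z > 0\<close>
    costs a constant, and \<open>B\<close> is finite.\<close>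
  have inner: "(\<Sum>y\<in>B. K x y * \<phi> y) \<le> A * K x z" for x
  proof -
    have "K x y * \<phi> y \<le> C * \<phi> y / K y z * K x z" for y
    proof -
      have "K x y * K y z \<le> C * K x z"
        using sum_K2[of "{y}" x z] by simp
      then have "K x y * K y z * \<phi> y \<le> C * K x z * \<phi> y"
        by (rule mult_right_mono) simp
      then show ?thesis using pos[of y z] by (simp add: field_simps)
    qed
    then show ?thesis by (simp add: A_def sum_distrib_right sum_mono)
  qed
  have split: "l * V x * \<phi> x = (\<Sum>y\<in>B. K x y * \<phi> y) + F x" for x
  proof -
    have "((\<lambda>y. K x y * \<phi> y) has_sum (\<Sum>y\<in>B. K x y * \<phi> y) + F x) (B \<union> - B)"
      using B(1) F by (intro has_sum_Un_disjoint has_sum_finite) auto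
    then show ?thesis using eig[of x] has_sum_unique by auto
  qed
  \<comment> \<open>Keeping \<open>Y\<close> finite lets the sums be exchanged without a Fubini
    argument.\<close>
  have sum_KF: "(\<Sum>y\<in>Y. K x y * F y) \<le> C * F x" if "finite Y" for Y x
  proof (rule has_sum_mono)
    show "((\<lambda>w. \<Sum>y\<in>Y. K x y * (K y w * \<phi> w)) has_sum (\<Sum>y\<in>Y. K x y * F y)) (- B)"
      using that F by (intro has_sum_finite_sum has_sum_cmult_right)
    show "((\<lambda>w. C * (K x w * \<phi> w)) has_sum C * F x) (- B)"
      using F by (intro has_sum_cmult_right)
    show "(\<Sum>y\<in>Y. K x y * (K y w * \<phi> w)) \<le> C * (K x w * \<phi> w)" for w
      using mult_right_mono[OF sum_K2[OF that, of x w], of "\<phi> w"]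
      by (simp add: sum_distrib_right mult.assoc)
  qed
  have outer: "F x \<le> A * K x z" for x
  proof -
    have "(\<Sum>y\<in>Y. K x y * \<phi> y) \<le> (A * K x z + F x) / 2" if Y: "finite Y" "Y \<subseteq> - B" for Y
    proof -
      have far: "2 * C * \<phi> y \<le> A * K y z + F y" if "y \<in> Y" for y
      proof -
        have "2 * C \<le> l * V y"
        proof -
          have "2 * C \<le> l * real M" using M(2) lam by (simp add: field_simps)
          also have "\<dots> \<le> l * V y" using B(2)[of y] Y(2) that lam by (intro mult_left_mono) auto
          finally show ?thesis .
        qed
        then have "2 * C * \<phi> y \<le> l * V y * \<phi> y" by (rule mult_right_mono) simp
        also have "\<dots> \<le> A * K y z + F y" using split[of y] inner[of y] by linarith
        finally show ?thesis .
      qed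
      have "2 * C * (\<Sum>y\<in>Y. K x y * \<phi> y) = (\<Sum>y\<in>Y. K x y * (2 * C * \<phi> y))"
        by (simp add: sum_distrib_left mult_ac)
      also have "\<dots> \<le> (\<Sum>y\<in>Y. K x y * (A * K y z + F y))"
        by (intro sum_mono mult_left_mono far) auto
      also have "\<dots> = A * (\<Sum>y\<in>Y. K x y * K y z) + (\<Sum>y\<in>Y. K x y * F y)"
        by (simp add: distrib_left sum.distrib sum_distrib_left mult_ac)
      also have "\<dots> \<le> A * (C * K x z) + C * F x"
        using A Y(1) by (intro add_mono mult_left_mono sum_K2 sum_KF) auto
      finally have "C * (2 * (\<Sum>y\<in>Y. K x y * \<phi> y)) \<le> C * (A * K x z + F x)"
        by (simp add: algebra_simps)
      then show ?thesis using C(1) by simp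
    qed
    \<comment> \<open>The bound is uniform in the finite sets \<open>Y\<close>, so it passes to the
      full sum. As \<open>F x\<close> is a real number, half of it can be subtracted.\<close>
    then have "F x \<le> (A * K x z + F x) / 2"
      unfolding F_def[of x] using summable by (intro infsum_le_finite_sums) (auto simp: F_def)
    then show ?thesis by simp
  qed
  \<comment> \<open>The extra 1 keeps the constant positive even if \<open>B\<close> is empty and
    \<open>A = 0\<close>.\<close>
  have "l * V x * \<phi> x \<le> (2 * A + 1) * K x z" for x
  proof -
    have "l * V x * \<phi> x \<le> 2 * (A * K x z)"
      using split[of x] inner[of x] outer[of x] by linarith
    also have "\<dots> \<le> (2 * A + 1) * K x z" by (simp add: algebra_simps)
    finally show ?thesis .
  qed
  then show ?thesis using A by (intro exI[of _ "2 * A + 1"]) auto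
qed

section \<open>The intrinsic kernel and its iterates\<close>

text \<open>This is Doob's transform of the kernel \<open>K x y / V x\<close> by an eigenfunction;
  its rows sum to 1 exactly by the eigenvalue equation.\<close>

definition h_transform ::
  "('a \<Rightarrow> 'a \<Rightarrow> real) \<Rightarrow> ('a \<Rightarrow> real) \<Rightarrow> real \<Rightarrow> ('a \<Rightarrow> real) \<Rightarrow> 'a \<Rightarrow> 'a \<Rightarrow> real" where
  "h_transform K V l \<phi> x y = K x y * \<phi> y / (l * V x * \<phi> x)"

definition kernel_op :: "('a \<Rightarrow> 'a \<Rightarrow> real) \<Rightarrow> ('a \<Rightarrow> real) \<Rightarrow> 'a \<Rightarrow> real" where
  "kernel_op q f x = (\<Sum>\<^sub>\<infinity>y. q x y * f y)"

text \<open>No summability of \<open>f\<close> is needed: the scalars factor out of a real \<open>infsum\<close> even if it is junk.\<close>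

lemma intrinsic_eq_kernel_op_power:
  assumes T: "\<And>h x. T (\<lambda>y. h y * \<phi> y) x = l * \<phi> x * kernel_op q h x"
    and "l \<noteq> 0" and "\<And>x. \<phi> x \<noteq> 0"
  shows "intrinsic T l \<phi> n f = (kernel_op q ^^ n) f"
proof -
  have hom: "kernel_op q (\<lambda>y. c * h y) x = c * kernel_op q h x" for c h x
    using infsum_cmult_right'[of c "\<lambda>y. q x y * h y" UNIV] by (simp add: kernel_op_def mult_ac)
  have "(T ^^ n) (\<lambda>y. f y * \<phi> y) = (\<lambda>x. (l ^ n * (kernel_op q ^^ n) f x) * \<phi> x)"
  proof (induction n)
    case (Suc n)
    have "(T ^^ Suc n) (\<lambda>y. f y * \<phi> y) = T (\<lambda>y. (l ^ n * (kernel_op q ^^ n) f y) * \<phi> y)"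
      by (simp add: Suc)
    also have "\<dots> = (\<lambda>x. (l ^ Suc n * (kernel_op q ^^ Suc n) f x) * \<phi> x)"
      by (rule ext, simp only: T hom, simp add: mult_ac)
    finally show ?case .
  qed simp
  then show ?thesis
    using assms(2,3) by (auto simp: intrinsic_def fun_eq_iff)
qed

lemma kernel_op_power_eq_markov_op_power:
  assumes "\<And>x y. pmf (k x) y = q x y" and "bounded (range f)"
  shows "(kernel_op q ^^ n) f = (markov_op k ^^ n) f"
proof (induction n)
  case (Suc n)
  show ?case
    by (rule ext)
      (simp add: Suc kernel_op_def[of q "(markov_op k ^^ n) f"] markov_op_def[of k "(markov_op k ^^ n) f"] assms(1)
        expectation_pmf_eq_infsum[OF bounded_markov_op_power[OF assms(2)]])
qed simp

section \<open>Measures with a density with respect to counting measure\<close>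

text \<open>Every point has positive mass, so only the empty set is null. The unit ball of the
  essential supremum norm thus consists of the functions bounded by 1 everywhere.\<close>

lemma esssup_density_count_space_le_iff:
  assumes "\<And>x. 0 < m x"
  shows "esssup (density (count_space UNIV) (\<lambda>x. ennreal (m x))) f \<le> c \<longleftrightarrow> (\<forall>x. f x \<le> c)"
proof
  let ?M = "density (count_space UNIV) (\<lambda>x. ennreal (m x))"
  assume "esssup ?M f \<le> c"
  moreover have "AE x in ?M. f x \<le> esssup ?M f" by (rule esssup_AE)
  ultimately show "\<forall>x. f x \<le> c"
    using assms by (auto simp: AE_density AE_count_space intro: order_trans)
qed (auto intro!: esssup_I)

lemma pmf_of_has_sum:
  fixes f :: "'a \<Rightarrow> real"
  assumes "(f has_sum 1) UNIV" and "\<And>x. 0 \<le> f x"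
  shows "\<exists>p. \<forall>x. pmf p x = f x"
proof -
  have "(\<integral>\<^sup>+x. ennreal (f x) \<partial>count_space UNIV) = 1"
    using assms nn_integral_count_space_summable[of f UNIV]
    by (auto simp: summable_on_def infsumI)
  then show ?thesis
    using assms(2) pmf_embed_pmf[of f] by blast
qed

lemma normalized_density_count_space:
  fixes m :: "'a \<Rightarrow> real"
  assumes m: "m summable_on UNIV" "\<And>x. 0 \<le> m x" and pos: "0 < infsum m UNIV"
    and p: "\<And>x. pmf p x = m x / infsum m UNIV"
  shows "normalized (density (count_space UNIV) (\<lambda>x. ennreal (m x))) = measure_pmf p"
proof -
  define T where "T = infsum m UNIV"
  define M where "M = density (count_space UNIV) (\<lambda>x. ennreal (m x))"
  have em: "emeasure M UNIV = ennreal T"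
    using nn_integral_count_space_summable[OF m] by (simp add: M_def emeasure_density T_def)
  have sp: "space M = UNIV"
    by (simp add: M_def)
  have emX: "emeasure M X = (\<integral>\<^sup>+x. ennreal (m x) * indicator X x \<partial>count_space UNIV)" for X
    by (simp add: M_def emeasure_density)
  have inv: "1 / ennreal T = ennreal (1 / T)"
    using pos by (simp add: T_def divide_ennreal flip: ennreal_1)
  have "emeasure (normalized M) X = emeasure (measure_pmf p) X" for X
  proof -
    have "emeasure (normalized M) X
      = (\<integral>\<^sup>+x. ennreal (1 / T) * (ennreal (m x) * indicator X x) \<partial>count_space UNIV)"
      by (subst nn_integral_cmult) (simp_all add: normalized_def sp em inv emX[of X])
    also have "\<dots> = (\<integral>\<^sup>+x. ennreal (pmf p x) * indicator X x \<partial>count_space UNIV)"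
      using pos m(2) by (intro nn_integral_cong)
        (simp add: p T_def ennreal_mult'[symmetric] flip: mult.assoc)
    also have "\<dots> = emeasure (measure_pmf p) X"
      by (simp add: measure_pmf_eq_density emeasure_density)
    finally show ?thesis .
  qed
  moreover have "sets (normalized M) = sets (measure_pmf p)"
    by (simp add: normalized_def M_def)
  ultimately show ?thesis
    unfolding M_def by (intro measure_eqI) auto
qed

section \<open>Ergodicity of the transformed kernel\<close>

text \<open>Stated for an abstract kernel \<open>K\<close>, eigenfunction \<open>\<phi>\<close> and
  invariant density \<open>m\<close>, so that it covers the semigroup and its dual alike.\<close>

lemma h_transform_ergodic:
  fixes K :: "'a \<Rightarrow> 'a \<Rightarrow> real"
  assumes sub: "subprob_kernel K" and pos: "\<And>x y. 0 < K x y"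
    and C: "0 < C" "\<And>x y. two_step K x y \<le> C * K x y"
    and V: "confining V" "\<And>x. 0 < V x" and phi: "\<And>x. 0 < \<phi> x" and lam: "0 < l"
    and eig: "\<And>x. ((\<lambda>y. K x y * \<phi> y) has_sum l * V x * \<phi> x) UNIV"
    and m: "\<And>x. 0 < m x" "m summable_on UNIV"
    and inv: "\<And>y. ((\<lambda>x. m x * h_transform K V l \<phi> x y) has_sum m y) UNIV"
    and S: "\<And>n f. S n f = (kernel_op (h_transform K V l \<phi>) ^^ n) f"
    and M: "M = density (count_space UNIV) (\<lambda>x. ennreal (m x))"
  shows "uniform_geometric_ergodic S M \<and> stationary S (normalized M) \<and>
    (\<forall>\<pi>. stationary S \<pi> \<longrightarrow> \<pi> = normalized M)"
proof -
  let ?q = "h_transform K V l \<phi>"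
  have den: "0 < l * V x * \<phi> x" for x
    using lam V(2) phi by simp
  have q_nonneg: "0 \<le> ?q x y" for x y
    using den[of x] pos[of x y] phi[of y] by (simp add: h_transform_def)
  have q_sum: "((\<lambda>y. ?q x y) has_sum 1) UNIV" for x
    using has_sum_cmult_left[OF eig[of x], of "1 / (l * V x * \<phi> x)"]
      lam V(2)[of x] phi[of x]
    by (simp add: h_transform_def)
  have "\<exists>p. \<forall>y. pmf p y = ?q x y" for x
    using pmf_of_has_sum[OF q_sum q_nonneg] .
  then obtain k where k: "\<And>x y. pmf (k x) y = ?q x y"
    by metis
  define T where "T = infsum m UNIV"
  \<comment> \<open>An arbitrary point, which later serves as the common atom in Doeblin's
    condition.\<close>
  fix z :: 'a
  have "m z \<le> T"
    using finite_sum_le_infsum[OF m(2), of "{z}"] m(1) by (simp add: T_def less_imp_le)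
  with m(1)[of z] have T: "0 < T" by linarith
  have "(m has_sum T) UNIV"
    unfolding T_def using m(2) by (rule has_sum_infsum)
  then have "((\<lambda>x. m x / T) has_sum 1) UNIV"
    using T has_sum_cmult_left[of m UNIV T "1 / T"] by simp
  then obtain p where p: "\<And>x. pmf p x = m x / T"
    using pmf_of_has_sum[of "\<lambda>x. m x / T"] T m(1) by (auto simp: less_imp_le)
  have p_inv: "bind_pmf p k = p"
  proof (rule pmf_eqI)
    fix y
    have bd: "bounded (range (\<lambda>x. pmf (k x) y))"
      unfolding bounded_iff by (intro exI[of _ 1]) (simp add: pmf_le_1)
    have "((\<lambda>x. pmf p x * pmf (k x) y) has_sum m y / T) UNIV"
      using has_sum_cmult_left[OF inv[of y], of "1 / T"] by (simp add: p k)
    then show "pmf (bind_pmf p k) y = pmf p y"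
      by (simp add: pmf_bind expectation_pmf_eq_infsum[OF bd] infsumI p)
  qed
  have norm_M: "normalized M = measure_pmf p"
    unfolding M using m T p by (intro normalized_density_count_space) (auto simp: T_def less_imp_le)
  have S_markov: "S n f = (markov_op k ^^ n) f" if "bounded (range f)" for n f
    using kernel_op_power_eq_markov_op_power[OF k that] by (simp add: S)
  obtain D where D: "0 < D" "\<And>x. l * V x * \<phi> x \<le> D * K x z"
    using eigenfunction_le_kernel[OF sub pos C V(1) phi lam eig] by blast
  \<comment> \<open>The cap 1/2 makes the rate \<open>1 - \<delta>\<close> strictly positive, as
    required of \<open>\<kappa>\<close>.\<close>
  define \<delta> where "\<delta> = min (\<phi> z / D) (1 / 2)"
  have \<delta>: "0 < \<delta>" "\<delta> \<le> 1" "\<delta> < 1"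
    using phi[of z] D(1) by (auto simp: \<delta>_def)
  have doeblin: "\<delta> \<le> pmf (k x) z" for x
  proof -
    have "\<phi> z / D \<le> K x z * \<phi> z / (l * V x * \<phi> x)"
      using mult_right_mono[OF D(2)[of x], of "\<phi> z"] D(1) den[of x] phi[of z]
      by (simp add: divide_simps mult_ac)
    then show ?thesis by (simp add: k h_transform_def \<delta>_def)
  qed
  have "uniform_geometric_ergodic S M"
    unfolding uniform_geometric_ergodic_def norm_M
  proof (intro exI conjI allI impI)
    \<comment> \<open>The constant 2 is the length of the interval from -1 to 1 that contains the
      values of \<open>g\<close>.\<close>
    show "0 < 1 - \<delta>" "1 - \<delta> < 1" "0 < (2 :: real)" using \<delta> by auto
    fix n :: nat
    show "(SUP x. SUP g\<in>{g. esssup M (\<lambda>y. ereal \<bar>g y\<bar>) \<le> 1}.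
      ennreal \<bar>S n g x - measure_pmf.expectation p g\<bar>) \<le> ennreal (2 * (1 - \<delta>) ^ n)"
    proof (intro SUP_least)
      fix x and g :: "'a \<Rightarrow> real"
      assume "g \<in> {g. esssup M (\<lambda>y. ereal \<bar>g y\<bar>) \<le> 1}"
      then have g: "\<bar>g y\<bar> \<le> 1" for y
        by (simp add: M esssup_density_count_space_le_iff m(1))
      then have "bounded (range g)"
        unfolding bounded_iff by (intro exI[of _ 1]) simp
      then show "ennreal \<bar>S n g x - measure_pmf.expectation p g\<bar> \<le> ennreal (2 * (1 - \<delta>) ^ n)"
        using doeblin_convergence[where f=g and n=n and x=x, OF doeblin \<delta>(2) p_inv g] by (simp add: S_markov)
    qed
  qed
  moreover have "stationary S (normalized M)"
    unfolding norm_M using S_markov p_inv by (rule doeblin_stationary)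
  moreover have "\<pi> = normalized M" if "stationary S \<pi>" for \<pi>
    unfolding norm_M by (rule doeblin_stationary_unique[OF S_markov doeblin \<delta>(1,2) p_inv that])
  ultimately show ?thesis by blast
qed

section \<open>Summability from square integrability, and duality\<close>

lemma ell2_mult_summable:
  fixes f g :: "'a \<Rightarrow> real"
  assumes "f \<in> ell2 \<mu>" and "g \<in> ell2 \<mu>" and "\<And>x. 0 \<le> f x" "\<And>x. 0 \<le> g x" "\<And>x. 0 \<le> \<mu> x"
  shows "(\<lambda>x. f x * g x * \<mu> x) summable_on UNIV"
proof (rule summable_on_comparison_test)
  show "(\<lambda>x. (f x)\<^sup>2 * \<mu> x + (g x)\<^sup>2 * \<mu> x) summable_on UNIV"
    using assms(1,2) by (intro summable_on_add) (simp_all add: ell2_def)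
  show "f x * g x * \<mu> x \<le> (f x)\<^sup>2 * \<mu> x + (g x)\<^sup>2 * \<mu> x" for x
  proof -
    have "2 * (f x * g x) \<le> (f x)\<^sup>2 + (g x)\<^sup>2"
      using sum_squares_bound[of "f x" "g x"] by simp
    moreover have "0 \<le> f x * g x" using assms(3,4) by simp
    ultimately have "f x * g x \<le> (f x)\<^sup>2 + (g x)\<^sup>2" by linarith
    then have "f x * g x * \<mu> x \<le> ((f x)\<^sup>2 + (g x)\<^sup>2) * \<mu> x"
      using assms(5) by (rule mult_right_mono)
    then show ?thesis by (simp add: distrib_right)
  qed
  show "0 \<le> f x * g x * \<mu> x" for x
    using assms(3-5) by simp
qed

text \<open>\<open>P(x, \<cdot>)/\<mu>\<close> lies in \<open>\<ell>\<^sup>2(\<mu>)\<close>, since \<open>P(x, y)\<^sup>2/\<mu>(y) \<le> D P(x, y)\<close>.\<close>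

lemma kernel_mult_ell2_summable:
  fixes f :: "'a \<Rightarrow> real"
  assumes K: "subprob_kernel K" and D: "\<And>y. K x y / \<mu> y \<le> D"
    and mu: "\<And>y. 0 < \<mu> y" and f: "f \<in> ell2 \<mu>" "\<And>y. 0 \<le> f y"
  shows "(\<lambda>y. K x y * f y) summable_on UNIV"
proof -
  have nn: "0 \<le> K x y" for y
    using K by (simp add: subprob_kernel_def)
  have "(\<lambda>y. D * K x y) summable_on UNIV"
    using K by (intro summable_on_cmult_right) (simp add: subprob_kernel_def)
  moreover have "(norm (K x y / \<mu> y))\<^sup>2 * \<mu> y \<le> D * K x y" for y
    using mult_right_mono[OF D[of y] nn[of y]] mu[of y] by (simp add: power2_eq_square)
  moreover have "0 \<le> (norm (K x y / \<mu> y))\<^sup>2 * \<mu> y" for y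
    using mu[of y] by simp
  ultimately have "(\<lambda>y. K x y / \<mu> y) \<in> ell2 \<mu>"
    unfolding ell2_def mem_Collect_eq by (rule summable_on_comparison_test)
  then have "(\<lambda>y. K x y / \<mu> y * f y * \<mu> y) summable_on UNIV"
    using f mu nn by (intro ell2_mult_summable) (auto simp: less_imp_le)
  moreover have "K x y / \<mu> y * f y * \<mu> y = K x y * f y" for y
    using mu[of y] by simp
  ultimately show ?thesis by simp
qed

text \<open>The weight of the intermediate point cancels along a two-step path. Hence the dual
  kernel inherits the two-step bound with the same constant.\<close>

lemma two_step_dual:
  assumes mu: "\<And>x. 0 < \<mu> x" and dual: "\<And>x y. \<mu> x * P x y = \<mu> y * Phat y x"
  shows "two_step Phat x y = \<mu> y / \<mu> x * two_step P y x"
proof -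
  have Phat: "Phat x y = \<mu> y / \<mu> x * P y x" for x y
    using dual[of y x] mu[of x] by (simp add: field_simps)
  have "Phat x z * Phat z y = \<mu> y / \<mu> x * (P y z * P z x)" for z
    using mu[of z] by (simp add: Phat)
  then show ?thesis by (simp only: two_step_def infsum_cmult_right')
qed

section \<open>Application to the semigroup and its dual\<close>

theorem theorem6p1:
  fixes P Phat :: "'a \<Rightarrow> 'a \<Rightarrow> real" and \<mu> V \<phi>\<^sub>0 \<phi>hat\<^sub>0 :: "'a \<Rightarrow> real"
    and Cs lam\<^sub>0 :: real
  assumes "countable (UNIV :: 'a set)" and "infinite (UNIV :: 'a set)"
    and "subprob_kernel P" and "subprob_kernel Phat"
    and "\<And>x. \<mu> x > 0"
    and "\<And>x y. \<mu> x * P x y = \<mu> y * Phat y x"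
    and "potential V"
    and "\<And>x y. P x y > 0"
    and "Cs \<ge> 1" and "\<And>x y. two_step P x y \<le> Cs * P x y"
    and "bdd_above (range (\<lambda>(x, y). P x y / \<mu> y))"
    and "confining V"
    and "lam\<^sub>0 = spectral_rad \<mu> (U_op P V)"
    and "positive_normalized_eigenfunction \<mu> (U_op P V) lam\<^sub>0 \<phi>\<^sub>0"
    and "positive_normalized_eigenfunction \<mu> (U_hat Phat V) lam\<^sub>0 \<phi>hat\<^sub>0"
  defines "\<nu> \<equiv> nu \<mu> \<phi>\<^sub>0 \<phi>hat\<^sub>0"
    and "Q \<equiv> intrinsic (U_op P V) lam\<^sub>0 \<phi>\<^sub>0"
    and "Qhat \<equiv> intrinsic (U_hat Phat V) lam\<^sub>0 \<phi>hat\<^sub>0"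
  shows "(uniform_geometric_ergodic Q \<nu> \<and>
          stationary Q (normalized \<nu>) \<and>
          (\<forall>\<pi>. stationary Q \<pi> \<longrightarrow> \<pi> = normalized \<nu>)) \<and>
         (uniform_geometric_ergodic Qhat \<nu> \<and>
          stationary Qhat (normalized \<nu>) \<and>
          (\<forall>\<pi>. stationary Qhat \<pi> \<longrightarrow> \<pi> = normalized \<nu>))"
proof -
  note P = assms(3) and Phat = assms(4) and mu = assms(5) and dual = assms(6) and pos = assms(8)
  have C: "0 < Cs" using assms(9) by simp
  have V: "0 < V x" for x
    using assms(7) by (simp add: potential_def)
  note eP = assms(14)[unfolded positive_normalized_eigenfunction_def]
  note eH = assms(15)[unfolded positive_normalized_eigenfunction_def]
  have phi: "0 < \<phi>\<^sub>0 x" and phihat: "0 < \<phi>hat\<^sub>0 x" for x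
    using eP eH by simp_all
  have Phat_eq: "Phat x y = \<mu> y / \<mu> x * P y x" for x y
    using dual[of y x] mu[of x] by (simp add: field_simps)
  have Phat_pos: "0 < Phat x y" for x y
    using mu pos by (simp add: Phat_eq)
  have Phat_two: "two_step Phat x y \<le> Cs * Phat x y" for x y
    using mult_left_mono[OF assms(10)[of y x], of "\<mu> y / \<mu> x"] mu[of x] mu[of y]
    by (simp add: two_step_dual[OF mu dual] Phat_eq mult_ac)
  obtain D where D: "\<And>x y. P x y / \<mu> y \<le> D"
    using assms(11) by (auto simp: bdd_above_def)
  \<comment> \<open>This is where the bound on \<open>P x y / \<mu> y\<close> enters. The sign of
    the eigenvalue is still open, so summability cannot yet be read off a nonzero value of the
    sum.\<close>
  have summable_P: "(\<lambda>y. P x y * \<phi>\<^sub>0 y) summable_on UNIV" for x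
    using eP by (intro kernel_mult_ell2_summable[OF P D mu]) (auto simp: less_imp_le)
  have infsum_P: "(\<Sum>\<^sub>\<infinity>y. P x y * \<phi>\<^sub>0 y) = lam\<^sub>0 * V x * \<phi>\<^sub>0 x" for x
  proof -
    have "U_op P V \<phi>\<^sub>0 x = lam\<^sub>0 * \<phi>\<^sub>0 x" using eP by simp
    then show ?thesis using V[of x] by (simp add: U_op_def field_simps)
  qed
  \<comment> \<open>The diagonal term alone makes the left side of the eigenvalue equation
    positive.\<close>
  have lam: "0 < lam\<^sub>0"
  proof -
    fix x :: 'a
    have "P x x * \<phi>\<^sub>0 x \<le> (\<Sum>\<^sub>\<infinity>y. P x y * \<phi>\<^sub>0 y)"
      using finite_sum_le_infsum[OF summable_P[of x], of "{x}"] pos phi by (simp add: less_imp_le)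
    with pos[of x x] phi[of x] have "0 < lam\<^sub>0 * (V x * \<phi>\<^sub>0 x)"
      unfolding infsum_P by (metis less_le_trans mult.assoc mult_pos_pos)
    moreover have "0 < V x * \<phi>\<^sub>0 x" using V phi by simp
    ultimately show ?thesis by (simp only: zero_less_mult_pos2)
  qed
  have eig_P: "((\<lambda>y. P x y * \<phi>\<^sub>0 y) has_sum lam\<^sub>0 * V x * \<phi>\<^sub>0 x) UNIV" for x
    using has_sum_infsum[OF summable_P[of x]] by (simp add: infsum_P)
  \<comment> \<open>In \<open>U_hat\<close> the factor \<open>1 / V\<close> stands inside the sum;
    moving it into the eigenfunction gives the equation the same form as for
    \<open>P\<close>.\<close>
  define \<psi> where "\<psi> x = \<phi>hat\<^sub>0 x / V x" for x
  have psi: "0 < \<psi> x" for x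
    using phihat V by (simp add: \<psi>_def)
  have eig_Phat: "((\<lambda>y. Phat x y * \<psi> y) has_sum lam\<^sub>0 * V x * \<psi> x) UNIV" for x
  proof -
    have "(\<Sum>\<^sub>\<infinity>y. Phat x y * \<psi> y) = U_hat Phat V \<phi>hat\<^sub>0 x"
      by (simp add: U_hat_def \<psi>_def)
    also have "\<dots> = lam\<^sub>0 * \<phi>hat\<^sub>0 x" using eH by simp
    finally have eq: "(\<Sum>\<^sub>\<infinity>y. Phat x y * \<psi> y) = lam\<^sub>0 * \<phi>hat\<^sub>0 x" .
    \<comment> \<open>A nonzero \<open>infsum\<close> is not a junk value.\<close>
    then have "(\<lambda>y. Phat x y * \<psi> y) summable_on UNIV"
      using lam phihat[of x] infsum_not_exists by fastforce
    from has_sum_infsum[OF this] show ?thesis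
      unfolding eq using V[of x] by (simp add: \<psi>_def)
  qed
  define m where "m x = \<phi>\<^sub>0 x * \<phi>hat\<^sub>0 x * \<mu> x" for x
  have m: "0 < m x" for x
    using phi phihat mu by (simp add: m_def)
  have m_summable: "m summable_on UNIV"
    unfolding m_def using eP eH mu by (intro ell2_mult_summable) (auto simp: less_imp_le)
  have \<nu>: "\<nu> = density (count_space UNIV) (\<lambda>x. ennreal (m x))"
    by (simp add: assms(16) nu_def m_def)
  \<comment> \<open>By duality, invariance for one kernel is the eigenvalue equation of the other:
    up to a factor depending on \<open>y\<close> only, the summand is
    \<open>Phat y x * \<psi> x\<close>.\<close>
  have inv_P: "((\<lambda>x. m x * h_transform P V lam\<^sub>0 \<phi>\<^sub>0 x y) has_sum m y) UNIV" for y
  proof -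
    let ?c = "\<phi>\<^sub>0 y * \<mu> y / lam\<^sub>0"
    have "m x * h_transform P V lam\<^sub>0 \<phi>\<^sub>0 x y = ?c * (Phat y x * \<psi> x)" for x
      using phi[of x] mu[of x] mu[of y] lam V[of x]
      by (simp add: m_def h_transform_def \<psi>_def Phat_eq field_simps)
    moreover have "m y = ?c * (lam\<^sub>0 * V y * \<psi> y)"
      using lam V[of y] by (simp add: m_def \<psi>_def)
    ultimately show ?thesis
      using has_sum_cmult_right[OF eig_Phat[of y], of ?c] by simp
  qed
  have inv_Phat: "((\<lambda>x. m x * h_transform Phat V lam\<^sub>0 \<psi> x y) has_sum m y) UNIV" for y
  proof -
    let ?c = "\<psi> y * \<mu> y / lam\<^sub>0"
    have "m x * h_transform Phat V lam\<^sub>0 \<psi> x y = ?c * (P y x * \<phi>\<^sub>0 x)" for x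
      using phihat[of x] mu[of x] mu[of y] lam V[of x]
      by (simp add: m_def h_transform_def \<psi>_def Phat_eq field_simps)
    moreover have "m y = ?c * (lam\<^sub>0 * V y * \<phi>\<^sub>0 y)"
      using lam V[of y] by (simp add: m_def \<psi>_def)
    ultimately show ?thesis
      using has_sum_cmult_right[OF eig_P[of y], of ?c] by simp
  qed
  have Q: "Q n f = (kernel_op (h_transform P V lam\<^sub>0 \<phi>\<^sub>0) ^^ n) f" for n f
    unfolding assms(17)
  proof (rule intrinsic_eq_kernel_op_power)
    show "U_op P V (\<lambda>y. h y * \<phi>\<^sub>0 y) x
      = lam\<^sub>0 * \<phi>\<^sub>0 x * kernel_op (h_transform P V lam\<^sub>0 \<phi>\<^sub>0) h x" for h x
    proof -
      have "h_transform P V lam\<^sub>0 \<phi>\<^sub>0 x y * h y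
        = 1 / (lam\<^sub>0 * V x * \<phi>\<^sub>0 x) * (P x y * (h y * \<phi>\<^sub>0 y))" for y
        by (simp add: h_transform_def)
      then have "kernel_op (h_transform P V lam\<^sub>0 \<phi>\<^sub>0) h x
        = 1 / (lam\<^sub>0 * V x * \<phi>\<^sub>0 x) * (\<Sum>\<^sub>\<infinity>y. P x y * (h y * \<phi>\<^sub>0 y))"
        unfolding kernel_op_def by (simp only: infsum_cmult_right')
      then show ?thesis using lam V[of x] phi[of x] by (simp add: U_op_def)
    qed
  qed (use lam phi in \<open>auto simp: less_imp_neq[symmetric]\<close>)
  have Qhat: "Qhat n f = (kernel_op (h_transform Phat V lam\<^sub>0 \<psi>) ^^ n) f" for n f
    unfolding assms(18)
  proof (rule intrinsic_eq_kernel_op_power)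
    show "U_hat Phat V (\<lambda>y. h y * \<phi>hat\<^sub>0 y) x
      = lam\<^sub>0 * \<phi>hat\<^sub>0 x * kernel_op (h_transform Phat V lam\<^sub>0 \<psi>) h x" for h x
    proof -
      \<comment> \<open>Since \<open>V x * \<psi> x\<close> equals
        \<open>\<phi>hat\<^sub>0 x\<close>, the transform by \<open>\<psi>\<close> is the intrinsic
        kernel of \<open>U_hat\<close> for \<open>\<phi>hat\<^sub>0\<close>.\<close>
      have "h_transform Phat V lam\<^sub>0 \<psi> x y * h y
        = 1 / (lam\<^sub>0 * \<phi>hat\<^sub>0 x) * (Phat x y * (1 / V y) * (h y * \<phi>hat\<^sub>0 y))" for y
        using V[of x] by (simp add: h_transform_def \<psi>_def mult_ac)
      then have "kernel_op (h_transform Phat V lam\<^sub>0 \<psi>) h x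
        = 1 / (lam\<^sub>0 * \<phi>hat\<^sub>0 x) * (\<Sum>\<^sub>\<infinity>y. Phat x y * (1 / V y) * (h y * \<phi>hat\<^sub>0 y))"
        unfolding kernel_op_def by (simp only: infsum_cmult_right')
      then show ?thesis using lam phihat[of x] by (simp add: U_hat_def)
    qed
  qed (use lam phihat in \<open>auto simp: less_imp_neq[symmetric]\<close>)
  show ?thesis
    using h_transform_ergodic[where S=Q,
        OF P pos C assms(10) assms(12) V phi lam eig_P m m_summable inv_P Q \<nu>]
      h_transform_ergodic[where S=Qhat,
        OF Phat Phat_pos C Phat_two assms(12) V psi lam eig_Phat m m_summable inv_Phat Qhat \<nu>]
    by blast
qed

end
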